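(* Let $(E,w,d)$ be an ultra triple, $r\ge 0$ an integer, $C\subseteq E$ a finite set, and $m$ a non-negative integer with $|C|\ge m$. Let $k\in\{0,1,\dots,m\}$ and let $A$ be a $k$-element subset of $C$ having maximum $r$-removed perimeter among all $k$-element subsets of $C$. Then there exists a greedy $r$-removed $m$-permutation $(c_1,\dots,c_m)$ of $C$ such that $\{c_1,\dots,c_k\}=A$ (i.e. $A$ is the set of elements of a prefix of it).
   Context: An ultra triple $(E,w,d)$ consists of a set $E$, an arbitrary function $w:E\to\mathbb{R}$, and a function $d$ defined on pairs of distinct points of $E$ with real values such that $d(a,b)=d(b,a)$ and $d(a,b)\le\max\{d(a,c),d(b,c)\}$ for all pairwise distinct $a,b,c\in E$ (distances may be negative). For a finite set $C\subseteq E$ and $v\in E\setminus C$, $\operatorname{dist}_r(C,v)$ is the maximum over all $S\subseteq C$ with $|S|=|C|-r$ of $\sum_{x\in S}d(v,x)$ if $|C|>r$, and $0$ if $|C|\le r$. For an ordered list $(a_1,\dots,a_k)$ of distinct points, $\operatorname{per}_r((a_1,\dots,a_k))=\sum_{i=1}^k w(a_i)+\sum_{i=1}^k\operatorname{dist}_r(\{a_1,\dots,a_{i-1}\},a_i)$; this value does not depend on the ordering, and for a finite set $A$, $\operatorname{per}_r(A)$ denotes the common value. A greedy $r$-removed $m$-permutation of a finite set $C$ is a list $(c_1,\dots,c_m)$ of $m$ distinct elements of $C$ such that for each $i\in\{1,\dots,m\}$ and each $x\in C\setminus\{c_1,\dots,c_{i-1}\}$ one has $\operatorname{per}_r((c_1,\dots,c_i))\ge\operatorname{per}_r((c_1,\dots,c_{i-1},x))$.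 *)

theory Defs
  imports Complex_Main
begin

text \<open>The distance \<^term>\<open>d\<close> is total as a HOL function, but only its values at pairs of distinct
  points of \<^term>\<open>E\<close> are constrained (and used); they may be negative. The weight \<^term>\<open>w\<close> is
  arbitrary.\<close>

definition ultra_triple :: "'a set \<Rightarrow> ('a \<Rightarrow> real) \<Rightarrow> ('a \<Rightarrow> 'a \<Rightarrow> real) \<Rightarrow> bool" where
  "ultra_triple E w d \<longleftrightarrow>
     (\<forall>a\<in>E. \<forall>b\<in>E. a \<noteq> b \<longrightarrow> d a b = d b a) \<and>
     (\<forall>a\<in>E. \<forall>b\<in>E. \<forall>c\<in>E. a \<noteq> b \<and> b \<noteq> c \<and> a \<noteq> c \<longrightarrow> d a b \<le> max (d a c) (d b c))"

text \<open>Meaningful for finite \<^term>\<open>C\<close> and \<^term>\<open>v \<notin> C\<close>.\<close>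

definition dist_rem :: "('a \<Rightarrow> 'a \<Rightarrow> real) \<Rightarrow> nat \<Rightarrow> 'a set \<Rightarrow> 'a \<Rightarrow> real" where
  "dist_rem d r C v =
     (if card C > r then Max {\<Sum>x\<in>S. d v x | S. S \<subseteq> C \<and> card S = card C - r} else 0)"

text \<open>The lists are indexed from 0, so that \<^term>\<open>set (take i xs)\<close> is the set of the points
  preceding \<^term>\<open>xs ! i\<close>.\<close>

definition per_list :: "('a \<Rightarrow> real) \<Rightarrow> ('a \<Rightarrow> 'a \<Rightarrow> real) \<Rightarrow> nat \<Rightarrow> 'a list \<Rightarrow> real" where
  "per_list w d r xs =
     (\<Sum>i<length xs. w (xs ! i)) + (\<Sum>i<length xs. dist_rem d r (set (take i xs)) (xs ! i))"

text \<open>The common value of the perimeters of all orderings of the finite set \<^term>\<open>A\<close>. For a finite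
  subset of an ultra triple the perimeter does not depend on the ordering, so that this value
  exists; it is unique since every finite set has an ordering.\<close>

definition per_set :: "('a \<Rightarrow> real) \<Rightarrow> ('a \<Rightarrow> 'a \<Rightarrow> real) \<Rightarrow> nat \<Rightarrow> 'a set \<Rightarrow> real" where
  "per_set w d r A = (THE p. \<forall>xs. distinct xs \<and> set xs = A \<longrightarrow> per_list w d r xs = p)"

definition greedy_perm ::
  "('a \<Rightarrow> real) \<Rightarrow> ('a \<Rightarrow> 'a \<Rightarrow> real) \<Rightarrow> nat \<Rightarrow> nat \<Rightarrow> 'a set \<Rightarrow> 'a list \<Rightarrow> bool" where
  "greedy_perm w d r m C cs \<longleftrightarrow>
     length cs = m \<and> distinct cs \<and> set cs \<subseteq> C \<and>
     (\<forall>i\<in>{1..m}. \<forall>x\<in>C - set (take (i - 1) cs).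
        per_list w d r (take i cs) \<ge> per_list w d r (take (i - 1) cs @ [x]))"

end

theory Submission
  imports Defs
begin

text \<open>Adding a point \<open>a\<close> to a set \<open>B\<close> of at least \<open>r\<close> points increases the \<open>r\<close>-removed distance
  from \<open>v\<close> by the larger of \<open>d v a\<close> and the \<open>r\<close>-th smallest distance from \<open>v\<close> to \<open>B\<close>. By the
  ultrametric inequality the points \<open>x\<close> and \<open>y\<close> have the same balls of radius at least \<open>d x y\<close>, so
  these increments agree for \<open>x\<close> and \<open>y\<close> whenever they are at least \<open>d x y\<close>. This gives the
  independence of the perimeter of the ordering. It also gives the exchange step: if a prefix \<open>B\<close> of
  a greedy permutation lies in the maximal set \<open>A\<close> and the greedy choice \<open>x\<close> is not in \<open>A\<close>, then
  the point \<open>y\<close> of \<open>A - B\<close> closest to \<open>x\<close> is a greedy choice as well, since otherwise replacing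
  \<open>y\<close> by \<open>x\<close> would increase the perimeter of \<open>A\<close>.\<close>

section \<open>Removed distances\<close>

text \<open>The maximum of \<open>t\<close> and the \<open>r\<close>-th smallest value of \<open>f\<close> on \<open>B\<close>; written with counts so that it
  makes sense for \<open>r = 0\<close> and depends on \<open>f\<close> only through its sublevel sets above \<open>t\<close>.\<close>

definition level :: "nat \<Rightarrow> ('a \<Rightarrow> real) \<Rightarrow> 'a set \<Rightarrow> real \<Rightarrow> real" where
  "level r f B t = Inf {s. t \<le> s \<and> r \<le> card {b\<in>B. f b \<le> s}}"

text \<open>Induction on \<open>r\<close>: a least value of \<open>f\<close> on the rest
  \<open>B - R\<close> supplies the next point.\<close>

lemma ex_smallest_subset:
  fixes f :: "'a \<Rightarrow> real"
  assumes "finite B" and "r \<le> card B"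
  shows "\<exists>R\<subseteq>B. card R = r \<and> (\<forall>u\<in>R. \<forall>v\<in>B - R. f u \<le> f v)"
  using assms(2)
proof (induction r)
  case 0
  then show ?case by (intro exI[of _ "{}"]) auto
next
  case (Suc r)
  then obtain R where R: "R \<subseteq> B" "card R = r" "\<forall>u\<in>R. \<forall>v\<in>B - R. f u \<le> f v"
    using Suc_leD by blast
  have fin: "finite R" "finite (B - R)" using R(1) assms(1) finite_subset by auto
  have "B - R \<noteq> {}" using R(1,2) Suc.prems fin(1) by (metis Diff_eq_empty_iff card_mono not_less_eq_eq)
  then have "Min (f ` (B - R)) \<in> f ` (B - R)" using fin(2) by (intro Min_in) auto
  then obtain p where "p \<in> B - R" "f p = Min (f ` (B - R))" by auto
  then have p: "p \<in> B - R" "\<forall>v\<in>B - R. f p \<le> f v" using fin(2) by auto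
  then show ?case
    using R fin by (intro exI[of _ "insert p R"]) auto
qed

text \<open>Removing \<open>r\<close> points nearest to \<open>x\<close> is optimal, so the maximum
  can be evaluated without comparing all subsets again.\<close>

lemma dist_rem_eq_sum_Diff:
  assumes fin: "finite B" and R: "R \<subseteq> B" "card R = r"
    and le: "\<And>u v. u \<in> R \<Longrightarrow> v \<in> B - R \<Longrightarrow> d x u \<le> d x v"
  shows "dist_rem d r B x = sum (d x) (B - R)"
proof (cases "card B > r")
  \<comment> \<open>Here \<open>R\<close> exhausts \<open>B\<close>; the empty sum agrees with the
    default value 0.\<close>
  case False
  then have "R = B" using R fin by (intro card_seteq) auto
  then show ?thesis using False by (simp add: dist_rem_def)
next
  case True
  define T where "T = B - R"
  have finR: "finite R" using R fin finite_subset by auto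
  have cT: "card T = card B - r" using R finR by (simp add: T_def card_Diff_subset)
  have finT: "finite T" using fin by (simp add: T_def)
  have "T \<noteq> {}" using cT True by auto
  \<comment> \<open>The threshold \<open>c\<close> separates \<open>R\<close> from \<open>T\<close>:
    terms \<open>d x y - c\<close> are nonnegative on \<open>T\<close> and nonpositive on
    \<open>R\<close>. As \<open>S\<close> and \<open>T\<close> have equal size, the shift cancels at
    the end.\<close>
  define c where "c = Min (d x ` T)"
  have cle: "c \<le> d x v" if "v \<in> T" for v using that finT by (simp add: c_def)
  have "c \<in> d x ` T" unfolding c_def using finT \<open>T \<noteq> {}\<close> by simp
  then have cge: "d x u \<le> c" if "u \<in> R" for u using that le by (auto simp: T_def)
  have opt: "sum (d x) S \<le> sum (d x) T" if S: "S \<subseteq> B" "card S = card B - r" for S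
  proof -
    have finS: "finite S" using S fin finite_subset by auto
    have "(\<Sum>y\<in>S. d x y - c) = (\<Sum>y\<in>S \<inter> T. d x y - c) + (\<Sum>y\<in>S - T. d x y - c)"
      using finS by (metis sum.Int_Diff)
    also have "\<dots> \<le> (\<Sum>y\<in>S \<inter> T. d x y - c)"
      using S cge by (auto simp: T_def intro!: sum_nonpos)
    also have "\<dots> \<le> (\<Sum>y\<in>T. d x y - c)"
      using finT cle by (intro sum_mono2) auto
    finally show ?thesis using S(2) cT by (simp add: sum_subtractf)
  qed
  have "Max {sum (d x) S | S. S \<subseteq> B \<and> card S = card B - r} = sum (d x) T"
  proof (rule Max_eqI)
    show "finite {sum (d x) S | S. S \<subseteq> B \<and> card S = card B - r}"
      using fin by (auto intro: finite_subset[of _ "sum (d x) ` Pow B"])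
    show "sum (d x) T \<in> {sum (d x) S | S. S \<subseteq> B \<and> card S = card B - r}"
      using cT by (auto simp: T_def)
  qed (use opt in auto)
  then show ?thesis using True by (simp add: dist_rem_def T_def)
qed

text \<open>If \<open>a\<close> is at least as far from \<open>x\<close> as all of \<open>R\<close>,
  then \<open>R\<close> is still removed and \<open>a\<close> is added to the sum. Otherwise
  \<open>a\<close> takes the place of a farthest point \<open>p\<close> of \<open>R\<close>, and
  \<open>p\<close> is added to the sum.\<close>

lemma dist_rem_insert:
  assumes fin: "finite B" and "a \<notin> B" and r: "r \<le> card B"
  shows "dist_rem d r (insert a B) x = dist_rem d r B x + level r (d x) B (d x a)"
proof -
  obtain R where R: "R \<subseteq> B" "card R = r" "\<forall>u\<in>R. \<forall>v\<in>B - R. d x u \<le> d x v"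
    using ex_smallest_subset[OF fin r] by blast
  have finR: "finite R" using R fin finite_subset by auto
  have dB: "dist_rem d r B x = sum (d x) (B - R)"
    using R fin by (intro dist_rem_eq_sum_Diff) auto
  have aR: "a \<notin> R" using R \<open>a \<notin> B\<close> by auto
  show ?thesis
  proof (cases "\<forall>u\<in>R. d x u \<le> d x a")
    case True
    have "dist_rem d r (insert a B) x = sum (d x) (insert a B - R)"
      using R fin True by (intro dist_rem_eq_sum_Diff) auto
    also have "\<dots> = d x a + sum (d x) (B - R)"
      using aR \<open>a \<notin> B\<close> fin by (simp add: insert_Diff_if)
    finally have 1: "dist_rem d r (insert a B) x = sum (d x) (B - R) + d x a" by simp
    have "card R \<le> card {b\<in>B. d x b \<le> d x a}"
      using True R fin by (intro card_mono) auto
    then have "level r (d x) B (d x a) = d x a"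
      unfolding level_def using R by (intro cInf_eq_minimum) auto
    then show ?thesis using 1 dB by simp
  next
    case False
    define q where "q = Max (d x ` R)"
    have ne: "R \<noteq> {}" using False by auto
    have qge: "d x u \<le> q" if "u \<in> R" for u using that finR by (simp add: q_def)
    have "q \<in> d x ` R" unfolding q_def using finR ne by simp
    then obtain p where p: "p \<in> R" "q = d x p" by auto
    have aq: "d x a \<le> q" using False qge by force
    have pB: "p \<in> B" using p R by auto
    have eq: "insert a B - insert a (R - {p}) = insert p (B - R)"
      using p pB aR \<open>a \<notin> B\<close> by auto
    have "dist_rem d r (insert a B) x = sum (d x) (insert a B - insert a (R - {p}))"
    proof (rule dist_rem_eq_sum_Diff)
      show "card (insert a (R - {p})) = r"
        using aR finR p R(2) by (metis DiffD1 card_Suc_Diff1 card_insert_disjoint finite_Diff)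
      show "d x u \<le> d x v" if "u \<in> insert a (R - {p})" "v \<in> insert a B - insert a (R - {p})" for u v
        using that R(3) p qge aq unfolding eq by (auto intro: order_trans)
    qed (use R fin in auto)
    also have "\<dots> = sum (d x) (B - R) + q" using p fin by (simp add: eq)
    finally have 1: "dist_rem d r (insert a B) x = sum (d x) (B - R) + q" .
    have "card R \<le> card {b\<in>B. d x b \<le> q}"
      using qge R fin by (intro card_mono) auto
    \<comment> \<open>Points outside \<open>R\<close> are at least as far as \<open>p\<close>, so a
      radius below \<open>q\<close> captures at most \<open>r - 1\<close> points.\<close>
    moreover have "q \<le> s" if "r \<le> card {b\<in>B. d x b \<le> s}" for s
    proof (rule ccontr)
      assume "\<not> q \<le> s"
      then have "{b\<in>B. d x b \<le> s} \<subseteq> R - {p}" using p R(3) by force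
      then have "card {b\<in>B. d x b \<le> s} \<le> card (R - {p})" using finR by (intro card_mono) auto
      also have "\<dots> < card R" using p finR by (intro card_Diff1_less) auto
      finally show False using that R by simp
    qed
    ultimately have "level r (d x) B (d x a) = q"
      unfolding level_def using R aq by (intro cInf_eq_minimum) auto
    then show ?thesis using 1 dB by simp
  qed
qed

lemma dist_rem_eq_0:
  "card B \<le> r \<Longrightarrow> dist_rem d r B x = 0"
  by (simp add: dist_rem_def)

lemma level_mono:
  assumes "finite B" and "r \<le> card B" and "s \<le> t"
  shows "level r f B s \<le> level r f B t"
  unfolding level_def
proof (rule cInf_superset_mono)
  \<comment> \<open>The sublevel set at \<open>M\<close> is all of \<open>B\<close>, so the set
    under \<open>Inf\<close> is nonempty.\<close>
  define M where "M = Max (insert t (f ` B))"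
  have "t \<le> M" "{b\<in>B. f b \<le> M} = B" using assms(1) by (auto simp: M_def)
  then show "{s. t \<le> s \<and> r \<le> card {b\<in>B. f b \<le> s}} \<noteq> {}" using assms(2) by auto
  show "bdd_below {u. s \<le> u \<and> r \<le> card {b\<in>B. f b \<le> u}}" by (auto intro: bdd_belowI[of _ s])
qed (use assms(3) in auto)

lemma level_cong:
  assumes "\<And>s b. t \<le> s \<Longrightarrow> b \<in> B \<Longrightarrow> f b \<le> s \<longleftrightarrow> g b \<le> s"
  shows "level r f B t = level r g B t"
proof -
  have "{b\<in>B. f b \<le> s} = {b\<in>B. g b \<le> s}" if "t \<le> s" for s using assms that by auto
  then show ?thesis unfolding level_def by (intro arg_cong[of _ _ Inf] Collect_cong) auto
qed

section \<open>Ultra triples\<close>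

lemma ultra_triple_sym:
  "ultra_triple E w d \<Longrightarrow> a \<in> E \<Longrightarrow> b \<in> E \<Longrightarrow> a \<noteq> b \<Longrightarrow> d a b = d b a"
  by (simp add: ultra_triple_def)

lemma ultra_triple_le:
  "ultra_triple E w d \<Longrightarrow> a \<in> E \<Longrightarrow> b \<in> E \<Longrightarrow> c \<in> E \<Longrightarrow> a \<noteq> b \<Longrightarrow> b \<noteq> c \<Longrightarrow> a \<noteq> c
    \<Longrightarrow> d a b \<le> max (d a c) (d b c)"
  unfolding ultra_triple_def by blast

lemma ultra_triple_ball_eq:
  assumes ut: "ultra_triple E w d" and "x \<in> E" "y \<in> E" "b \<in> E" "x \<noteq> y" "b \<noteq> x" "b \<noteq> y"
    and "d x y \<le> s"
  shows "d x b \<le> s \<longleftrightarrow> d y b \<le> s"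
proof -
  have "d x b \<le> max (d x y) (d b y)" "d y b \<le> max (d y x) (d b x)"
    using assms by (auto intro!: ultra_triple_le[OF ut])
  moreover have "d b y = d y b" "d b x = d x b" "d y x = d x y"
    using assms ultra_triple_sym[OF ut] by auto
  ultimately show ?thesis using \<open>d x y \<le> s\<close> by auto
qed

lemma ultra_triple_level_eq:
  assumes "ultra_triple E w d" "x \<in> E" "y \<in> E" "x \<noteq> y" "B \<subseteq> E - {x, y}" "d x y \<le> t"
  shows "level r (d x) B t = level r (d y) B t"
proof (rule level_cong)
  show "d x b \<le> s \<longleftrightarrow> d y b \<le> s" if "t \<le> s" "b \<in> B" for s b
    using that assms by (intro ultra_triple_ball_eq[of E w]) auto
qed

text \<open>This is invariance of the perimeter under exchanging the last two points. Both
  increments are levels truncated at \<open>d a b\<close>, where \<open>a\<close> and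
  \<open>b\<close> have the same balls.\<close>

lemma dist_rem_swap:
  assumes ut: "ultra_triple E w d" and "a \<in> E" "b \<in> E" "a \<noteq> b" and B: "finite B" "B \<subseteq> E - {a, b}"
  shows "dist_rem d r B a + dist_rem d r (insert a B) b = dist_rem d r B b + dist_rem d r (insert b B) a"
proof (cases "r \<le> card B")
  case True
  have "d b a = d a b" using assms ultra_triple_sym[OF ut] by auto
  then have "level r (d b) B (d b a) = level r (d a) B (d a b)"
    using assms by (simp add: ultra_triple_level_eq[OF ut, of a b])
  moreover have "a \<notin> B" "b \<notin> B" using B by auto
  ultimately show ?thesis using dist_rem_insert[OF B(1) _ True] by simp
next
  \<comment> \<open>Even after one insertion there are at most \<open>r\<close> points, so all four
    terms vanish.\<close>
  case False
  then show ?thesis using B by (auto simp: dist_rem_eq_0 card_insert_if)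
qed

text \<open>The points of \<open>D - B\<close> are added one at a time. Each is at distance at least
  \<open>d x y\<close> from \<open>x\<close>, so it raises the distance from \<open>x\<close> by at
  least as much as that from \<open>y\<close>.\<close>

lemma dist_rem_diff_mono:
  assumes ut: "ultra_triple E w d" and xy: "x \<in> E" "y \<in> E" "x \<noteq> y"
    and D: "finite D" "D \<subseteq> E - {x, y}" and "B \<subseteq> D"
    and close: "\<And>a. a \<in> D - B \<Longrightarrow> d x y \<le> d x a"
  shows "dist_rem d r B x - dist_rem d r B y \<le> dist_rem d r D x - dist_rem d r D y"
proof -
  have "X \<subseteq> D - B \<Longrightarrow>
    dist_rem d r B x - dist_rem d r B y \<le> dist_rem d r (B \<union> X) x - dist_rem d r (B \<union> X) y"
    if "finite X" for X
    using that
  proof (induction X)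
    case empty
    then show ?case by simp
  next
    case (insert a X)
    define F where "F = B \<union> X"
    have F: "finite F" "a \<notin> F" "F \<subseteq> E - {x, y}"
      using insert D \<open>B \<subseteq> D\<close> finite_subset by (auto simp: F_def)
    have a: "a \<in> E" "a \<noteq> x" "a \<noteq> y" "d x y \<le> d x a" using insert.prems D close by auto
    have IH: "dist_rem d r B x - dist_rem d r B y \<le> dist_rem d r F x - dist_rem d r F y"
      using insert by (simp add: F_def)
    have "dist_rem d r F x - dist_rem d r F y
      \<le> dist_rem d r (insert a F) x - dist_rem d r (insert a F) y"
    proof (cases "r \<le> card F")
      case True
      \<comment> \<open>Ball equality at radius \<open>d x a\<close>: the ball around
        \<open>x\<close> contains \<open>a\<close>, hence so does the one around
        \<open>y\<close>.\<close>
      have "d y a \<le> d x a"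
        using ultra_triple_ball_eq[OF ut xy(1,2) a(1) xy(3) a(2,3,4)] by simp
      then have "level r (d y) F (d y a) \<le> level r (d y) F (d x a)"
        by (rule level_mono[OF F(1) True])
      also have "\<dots> = level r (d x) F (d x a)"
        using ultra_triple_level_eq[OF ut xy F(3) a(4)] by simp
      finally show ?thesis using dist_rem_insert[OF F(1,2) True] by simp
    next
      case False
      then show ?thesis using F by (simp add: dist_rem_eq_0)
    qed
    then show ?case using IH by (simp add: F_def)
  qed
  from this[of "D - B"] show ?thesis using D \<open>B \<subseteq> D\<close> by (simp add: Un_absorb1)
qed

section \<open>Perimeters\<close>

lemma per_list_append1:
  "per_list w d r (xs @ [x]) = per_list w d r xs + w x + dist_rem d r (set xs) x"
  by (simp add: per_list_def nth_append)

text \<open>Induction on the length. If the last entries \<open>a\<close> and \<open>b\<close>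
  differ, the induction hypothesis reorders the prefixes so that the lists end in
  \<open>b, a\<close> and \<open>a, b\<close> after a common \<open>zs\<close>;
  \<open>dist_rem_swap\<close> then compares them.\<close>

lemma per_list_eq:
  assumes ut: "ultra_triple E w d"
  shows "\<lbrakk>distinct xs; distinct ys; set xs = set ys; set xs \<subseteq> E\<rbrakk>
    \<Longrightarrow> per_list w d r xs = per_list w d r ys"
proof (induction "length xs" arbitrary: xs ys rule: less_induct)
  case less
  have len: "length ys = length xs" using less.prems by (metis distinct_card)
  show ?case
  proof (cases xs rule: rev_exhaust)
    case Nil
    then show ?thesis using less.prems by simp
  next
    case (snoc xs' a)
    then obtain ys' b where ys: "ys = ys' @ [b]" using less.prems by (cases ys rule: rev_exhaust) auto
    note IH = less.hyps
    show ?thesis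
    proof (cases "a = b")
      case True
      then have "set xs' = set ys'" using less.prems snoc ys by auto
      then show ?thesis
        using IH[of xs' ys'] less.prems snoc ys True by (simp add: per_list_append1)
    next
      case False
      obtain zs where zs: "set zs = set xs - {a, b}" "distinct zs"
        using finite_distinct_list[of "set xs - {a, b}"] by auto
      have sx: "set xs' = set (zs @ [b])" and sy: "set ys' = set (zs @ [a])"
        using zs(1) less.prems(1-3) False unfolding snoc ys by auto
      have zs': "a \<notin> set zs" "b \<notin> set zs" "set zs \<subseteq> E"
        using zs(1) less.prems(4) by auto
      have xs': "a \<in> E" "set xs' \<subseteq> E" "length xs' < length xs" "distinct xs'"
        using less.prems(1,4) snoc by auto
      have ys': "b \<in> E" "set ys' \<subseteq> E" "length ys' < length xs" "distinct ys'"
        using less.prems(2-4) len ys by auto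
      have "per_list w d r xs' = per_list w d r (zs @ [b])"
        using zs' zs(2) xs' sx by (intro IH) auto
      moreover have "per_list w d r ys' = per_list w d r (zs @ [a])"
        using zs' zs(2) ys' sy by (intro IH) auto
      moreover have "dist_rem d r (set zs) a + dist_rem d r (insert a (set zs)) b
          = dist_rem d r (set zs) b + dist_rem d r (insert b (set zs)) a"
        using zs' xs'(1) ys'(1) False by (intro dist_rem_swap[OF ut]) auto
      ultimately show ?thesis
        using sx sy by (simp add: snoc ys per_list_append1)
    qed
  qed
qed

lemma per_set_eq_per_list:
  assumes "ultra_triple E w d" and "distinct xs" and "set xs \<subseteq> E"
  shows "per_set w d r (set xs) = per_list w d r xs"
  unfolding per_set_def
proof (rule the_equality)
  show "\<forall>ys. distinct ys \<and> set ys = set xs \<longrightarrow> per_list w d r ys = per_list w d r xs"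
    using assms per_list_eq[OF assms(1)] by blast
qed (use assms in blast)

lemma per_set_insert:
  assumes "ultra_triple E w d" and "finite A" and "a \<notin> A" and "insert a A \<subseteq> E"
  shows "per_set w d r (insert a A) = per_set w d r A + w a + dist_rem d r A a"
proof -
  obtain xs where xs: "set xs = A" "distinct xs" using finite_distinct_list[OF assms(2)] by auto
  have "per_set w d r (set (xs @ [a])) = per_list w d r (xs @ [a])"
    using assms xs by (intro per_set_eq_per_list) auto
  also have "\<dots> = per_set w d r A + w a + dist_rem d r A a"
    using assms xs per_set_eq_per_list[of E w d xs] by (simp add: per_list_append1)
  finally show ?thesis using xs by simp
qed

section \<open>Greedy permutations\<close>

lemma greedy_perm_append1:
  assumes gr: "greedy_perm w d r m C cs" and x: "x \<in> C - set cs"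
    and best: "\<And>z. z \<in> C - set cs \<Longrightarrow> w z + dist_rem d r (set cs) z \<le> w x + dist_rem d r (set cs) x"
  shows "greedy_perm w d r (Suc m) C (cs @ [x])"
proof -
  have len: "length cs = m" using gr by (simp add: greedy_perm_def)
  have "per_list w d r (take (i - 1) (cs @ [x]) @ [z]) \<le> per_list w d r (take i (cs @ [x]))"
    if i: "i \<in> {1..Suc m}" and z: "z \<in> C - set (take (i - 1) (cs @ [x]))" for i z
  proof (cases "i = Suc m")
    \<comment> \<open>Only this condition is new; the common summand
      \<open>per_list w d r cs\<close> cancels.\<close>
    case True
    then show ?thesis using z len best by (simp add: per_list_append1)
  next
    case False
    then show ?thesis using i z len gr by (auto simp: greedy_perm_def)
  qed
  then show ?thesis using gr x by (auto simp: greedy_perm_def)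
qed

lemma ex_greedy_choice:
  fixes w :: "'a \<Rightarrow> real"
  assumes "finite C" and "B \<subset> C"
  shows "\<exists>x\<in>C - B. \<forall>z\<in>C - B. w z + dist_rem d r B z \<le> w x + dist_rem d r B x"
proof -
  let ?g = "\<lambda>z. w z + dist_rem d r B z"
  have "Max (?g ` (C - B)) \<in> ?g ` (C - B)" using assms by (intro Max_in) auto
  then obtain x where "x \<in> C - B" "?g x = Max (?g ` (C - B))" by auto
  moreover have "?g z \<le> Max (?g ` (C - B))" if "z \<in> C - B" for z using that assms by simp
  ultimately show ?thesis by metis
qed

lemma greedy_choice_in_maximal:
  assumes ut: "ultra_triple E w d" and C: "C \<subseteq> E" "finite C" and A: "A \<subseteq> C" and "B \<subset> A"
    and max: "\<And>F. F \<subseteq> C \<Longrightarrow> card F = card A \<Longrightarrow> per_set w d r F \<le> per_set w d r A"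
  shows "\<exists>y\<in>A - B. \<forall>z\<in>C - B. w z + dist_rem d r B z \<le> w y + dist_rem d r B y"
proof -
  obtain x where x: "x \<in> C - B" "\<And>z. z \<in> C - B \<Longrightarrow> w z + dist_rem d r B z \<le> w x + dist_rem d r B x"
    using ex_greedy_choice[OF C(2), of B w d r] \<open>B \<subset> A\<close> A by (metis order_less_le_trans)
  show ?thesis
  proof (cases "x \<in> A")
    case True
    then show ?thesis using x by auto
  next
    case False
    have finA: "finite A" using A C finite_subset by auto
    have "Min (d x ` (A - B)) \<in> d x ` (A - B)" using finA \<open>B \<subset> A\<close> by (intro Min_in) auto
    \<comment> \<open>Taking \<open>y\<close> nearest to \<open>x\<close> provides the closeness
      hypothesis of \<open>dist_rem_diff_mono\<close>.\<close>
    then obtain y where y: "y \<in> A - B" "d x y = Min (d x ` (A - B))" by auto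
    have ymin: "d x y \<le> d x a" if "a \<in> A - B" for a using that finA y(2) by simp
    define D where "D = A - {y}"
    have D: "finite D" "D \<subseteq> E - {x, y}" "B \<subseteq> D" "A = insert y D" "y \<notin> D" "x \<notin> D"
      using finA A C y False \<open>B \<subset> A\<close> by (auto simp: D_def)
    have "D \<subseteq> E" using D(2) by auto
    have xyE: "x \<in> E" "y \<in> E" "x \<noteq> y" using x y A C False by auto
    \<comment> \<open>Maximality of \<open>A\<close> against \<open>A\<close> with \<open>y\<close>
      replaced by \<open>x\<close>, a set of the same size.\<close>
    have "per_set w d r (insert x D) \<le> per_set w d r A"
      using A x D by (intro max) auto
    then have "w x + dist_rem d r D x \<le> w y + dist_rem d r D y"
      using per_set_insert[OF ut D(1), of x r] per_set_insert[OF ut D(1), of y r] \<open>D \<subseteq> E\<close> D xyE by auto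
    moreover have "dist_rem d r B x - dist_rem d r B y \<le> dist_rem d r D x - dist_rem d r D y"
      using D ymin by (intro dist_rem_diff_mono[OF ut xyE]) auto
    ultimately have "w x + dist_rem d r B x \<le> w y + dist_rem d r B y" by simp
    then show ?thesis using x(2) y(1) order_trans by blast
  qed
qed

theorem theorem3p8:
  fixes E C A :: "'a set" and w :: "'a \<Rightarrow> real" and d :: "'a \<Rightarrow> 'a \<Rightarrow> real" and r m k :: nat
  assumes "ultra_triple E w d"
    and "C \<subseteq> E" and "finite C" and "card C \<ge> m"
    and "k \<le> m"
    and "A \<subseteq> C" and "card A = k"
    and "\<And>B. B \<subseteq> C \<Longrightarrow> card B = k \<Longrightarrow> per_set w d r B \<le> per_set w d r A"
  shows "\<exists>cs. greedy_perm w d r m C cs \<and> set (take k cs) = A"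
proof -
  have finA: "finite A" using assms(3,6) by (rule rev_finite_subset)
  \<comment> \<open>Up to length \<open>k\<close>, greedy choices can be kept inside
    \<open>A\<close>; at length \<open>k\<close> they fill it by cardinality.\<close>
  have "\<exists>cs. greedy_perm w d r j C cs \<and> set cs \<subseteq> A" if "j \<le> k" for j
    using that
  proof (induction j)
    case 0
    then show ?case by (simp add: greedy_perm_def)
  next
    case (Suc j)
    then obtain cs where cs: "greedy_perm w d r j C cs" "set cs \<subseteq> A" by auto
    then have "card (set cs) = j" by (auto simp: greedy_perm_def distinct_card)
    then have "set cs \<subset> A" using cs Suc.prems assms(7) by auto
    then obtain y where y: "y \<in> A - set cs"
      "\<forall>z\<in>C - set cs. w z + dist_rem d r (set cs) z \<le> w y + dist_rem d r (set cs) y"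
      using greedy_choice_in_maximal[OF assms(1,2,3,6) \<open>set cs \<subset> A\<close>, of r]
        assms(8)[folded assms(7)] by auto
    have "greedy_perm w d r (Suc j) C (cs @ [y])"
      using y assms(6) by (intro greedy_perm_append1[OF cs(1)]) auto
    then show ?case using y(1) cs(2) by (intro exI[of _ "cs @ [y]"]) auto
  qed
  then obtain as where as: "greedy_perm w d r k C as" "set as \<subseteq> A" by auto
  have len: "length as = k" "distinct as" using as(1) by (auto simp: greedy_perm_def)
  then have "set as = A" using as(2) finA assms(7) by (metis card_subset_eq distinct_card)
  \<comment> \<open>Beyond \<open>k\<close> any greedy choice from \<open>C\<close> will do, since
    appending leaves the prefix \<open>as\<close> unchanged.\<close>
  have "\<exists>cs. greedy_perm w d r j C cs \<and> take k cs = as" if "k \<le> j" "j \<le> m" for j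
    using that
  proof (induction j rule: dec_induct)
    case base
    then show ?case using as(1) len by (intro exI[of _ as]) auto
  next
    case (step j)
    then obtain cs where cs: "greedy_perm w d r j C cs" "take k cs = as" by auto
    then have cj: "length cs = j" "card (set cs) = j" "set cs \<subseteq> C"
      by (auto simp: greedy_perm_def distinct_card)
    then have "set cs \<subset> C" using step assms(4) by auto
    then obtain x where x: "x \<in> C - set cs"
      "\<forall>z\<in>C - set cs. w z + dist_rem d r (set cs) z \<le> w x + dist_rem d r (set cs) x"
      using ex_greedy_choice[OF assms(3)] by blast
    have "greedy_perm w d r (Suc j) C (cs @ [x])"
      using x by (intro greedy_perm_append1[OF cs(1)]) auto
    then show ?case using cs(2) cj(1) step by (intro exI[of _ "cs @ [x]"]) auto
  qed
  then show ?thesis using assms(5) \<open>set as = A\<close> by blast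
qed

end
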